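(* For every $\ell\in\mathbb N_+$ there is a function $\eta_\ell(n,\epsilon)$ with the property that for every $\alpha>0$ there is $\epsilon_0>0$ such that for every $\epsilon\in(0,\epsilon_0)$ there is $N_0\in\mathbb N$ with $|\eta_\ell(n,\epsilon)|<\alpha$ for all $n\ge N_0$, and such that the following holds: for every $n_0\in\mathbb N_+$ and every $\epsilon\in(0,1/3)$, there exists a graph $G$ with $|G|=n\ge n_0$ and $\mathrm{Lit}(G)\le\ell$ such that every $\epsilon$-good equipartition of $G$ has size at least $$\bigl(1+\eta_\ell(n,\epsilon)\bigr)\cdot\epsilon^{-\ell-1}.$$
   Context: Graphs are finite, simple, undirected; $|G|=|V(G)|$; $N^1_G(v)=N_G(v)$ and $N^0_G(v)=V(G)\setminus N_G(v)$. $\mathrm{Lit}(G)$ is the largest $t\in\mathbb N$ for which there are vertices $x_\sigma$ ($\sigma\in\{0,1\}^{<t}$, binary strings of length less than $t$) and $w_\tau$ ($\tau\in\{0,1\}^t$) of $G$ such that for all $\tau\in\{0,1\}^t$ and $i\in[t]$: $x_{\tau|_{[i-1]}}\in N_G(w_\tau)\iff\tau_i=1$. A non-empty $U\subseteq V(G)$ is $\epsilon$-good in $G$ if for every $v\in V(G)$ there is $b\in\{0,1\}$ with $|N_G^b(v)\cap U|\ge(1-\epsilon)|U|$. An $\epsilon$-good equipartition of $G$ is a partition of $V(G)$ all of whose parts are $\epsilon$-good in $G$ and whose part sizes pairwise differ by at most $1$; its size is its number of parts. *)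

theory Defs
  imports Complex_Main "HOL-Library.Disjoint_Sets" "Graph_Theory.Pair_Digraph"
begin

(* Finite simple undirected graphs are the structures satisfying the locale predicate pair_graph:
   finite vertex set, and a symmetric, loop-free arc relation, so that an undirected edge {u,v}
   is represented by the two arcs (u,v) and (v,u). *)

definition nbh :: "'a pair_pre_digraph \<Rightarrow> 'a \<Rightarrow> 'a set" where
  "nbh G v = {u \<in> pverts G. (v, u) \<in> parcs G}"

(* The exponent b in {0,1} of N^b is a Boolean: True stands for 1. *)
definition nbh_pow :: "bool \<Rightarrow> 'a pair_pre_digraph \<Rightarrow> 'a \<Rightarrow> 'a set" where
  "nbh_pow b G v = (if b then nbh G v else pverts G - nbh G v)"

(* Binary strings are Boolean lists (True = 1), indexed from 0: the condition at position i < t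
   is the one usually written for i + 1 in {1..t}.  The vertices need not be distinct. *)
definition has_littlestone_tree :: "'a pair_pre_digraph \<Rightarrow> nat \<Rightarrow> bool" where
  "has_littlestone_tree G t \<longleftrightarrow>
    (\<exists>x w :: bool list \<Rightarrow> 'a.
      (\<forall>\<sigma>. length \<sigma> < t \<longrightarrow> x \<sigma> \<in> pverts G) \<and>
      (\<forall>\<tau>. length \<tau> = t \<longrightarrow> w \<tau> \<in> pverts G) \<and>
      (\<forall>\<tau>. length \<tau> = t \<longrightarrow> (\<forall>i<t. x (take i \<tau>) \<in> nbh G (w \<tau>) \<longleftrightarrow> \<tau> ! i)))"

definition Lit :: "'a pair_pre_digraph \<Rightarrow> nat" where
  "Lit G = (GREATEST t. has_littlestone_tree G t)"

(* The maximum defining Lit exists for every graph with at least one vertex: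
   t = 0 is always admissible, and an admissible t satisfies 2 ^ t <= |G|. *)

lemma has_littlestone_tree_0: "pverts G \<noteq> {} \<Longrightarrow> has_littlestone_tree G 0"
  unfolding has_littlestone_tree_def by auto

lemma has_littlestone_tree_bound:
  assumes fin: "finite (pverts G)" and tree: "has_littlestone_tree G t"
  shows "2 ^ t \<le> card (pverts G)"
proof -
  obtain x w where w: "\<And>\<tau>. length \<tau> = t \<Longrightarrow> w \<tau> \<in> pverts G"
    and adj: "\<And>\<tau> i. length \<tau> = t \<Longrightarrow> i < t \<Longrightarrow> x (take i \<tau>) \<in> nbh G (w \<tau>) \<longleftrightarrow> \<tau> ! i"
    using tree unfolding has_littlestone_tree_def by blast
  let ?L = "{\<tau> :: bool list. length \<tau> = t}"
  have "inj_on w ?L"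
  proof (rule inj_onI)
    fix \<tau> \<tau>' assume L: "\<tau> \<in> ?L" "\<tau>' \<in> ?L" and eq: "w \<tau> = w \<tau>'"
    have "take i \<tau> = take i \<tau>'" if "i \<le> t" for i
      using that
    proof (induction i)
      case (Suc i)
      then have "\<tau> ! i = \<tau>' ! i"
        using adj[of \<tau> i] adj[of \<tau>' i] L eq by auto
      then show ?case using Suc L by (simp add: take_Suc_conv_app_nth)
    qed simp
    from this[of t] L show "\<tau> = \<tau>'" by simp
  qed
  then have "card ?L \<le> card (pverts G)"
    by (rule card_inj_on_le) (use w fin in auto)
  then show ?thesis
    using card_lists_length_eq[of "UNIV :: bool set" t] by simp
qed

lemma has_littlestone_tree_Lit:
  assumes "finite (pverts G)" "pverts G \<noteq> {}"
  shows "has_littlestone_tree G (Lit G)"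
  unfolding Lit_def
proof (rule GreatestI_nat)
  show "has_littlestone_tree G 0" using assms(2) by (rule has_littlestone_tree_0)
  show "t \<le> card (pverts G)" if "has_littlestone_tree G t" for t
    using has_littlestone_tree_bound[OF assms(1) that] less_exp[of t] by linarith
qed

lemma Lit_greatest:
  assumes "finite (pverts G)" "has_littlestone_tree G t"
  shows "t \<le> Lit G"
  unfolding Lit_def
proof (rule Greatest_le_nat)
  show "has_littlestone_tree G t" by (rule assms(2))
  show "s \<le> card (pverts G)" if "has_littlestone_tree G s" for s
    using has_littlestone_tree_bound[OF assms(1) that] less_exp[of s] by linarith
qed

definition good_set :: "real \<Rightarrow> 'a pair_pre_digraph \<Rightarrow> 'a set \<Rightarrow> bool" where
  "good_set \<epsilon> G U \<longleftrightarrow> U \<noteq> {} \<and> U \<subseteq> pverts G \<and>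
    (\<forall>v\<in>pverts G. \<exists>b. real (card (nbh_pow b G v \<inter> U)) \<ge> (1 - \<epsilon>) * real (card U))"

definition good_equipartition :: "real \<Rightarrow> 'a pair_pre_digraph \<Rightarrow> 'a set set \<Rightarrow> bool" where
  "good_equipartition \<epsilon> G P \<longleftrightarrow> partition_on (pverts G) P \<and>
    (\<forall>U\<in>P. good_set \<epsilon> G U) \<and>
    (\<forall>U\<in>P. \<forall>W\<in>P. \<bar>int (card U) - int (card W)\<bar> \<le> 1)"

end

theory Submission
  imports Defs "HOL-Library.Sublist" "HOL-Library.Nat_Bijection"
begin

text \<open>Take the words of length \<open>l\<close> over \<open>m \<approx> 1/\<epsilon>\<close> letters. Each is a cell of \<open>a\<close> independent
  points; together the cells carry only an \<open>\<epsilon>\<close>-fraction of the graph, and one extra cell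
  carries the rest, slightly less than a \<open>(1 - \<epsilon>)\<close>-fraction. The boundedly many remaining vertices
  are centres, one for each nonempty prefix of a word, joined to all points of the cells below it.
  Neighbourhoods of centres form a laminar family of depth \<open>l\<close>, which bounds \<open>Lit\<close>.
  Since \<open>(m + 1)\<epsilon> < 1\<close>, a large good set cannot be spread out over the children of a prefix, so
  it lies mostly in a single cell. Parts noticeably larger than \<open>a \<approx> \<epsilon>\<^sup>l\<^sup>+\<^sup>1 n\<close> would all have to lie
  mostly in the extra cell, which is slightly too small for that.\<close>

section \<open>Littlestone trees as recursive shattering\<close>

text \<open>Only the leaves \<open>w\<close> of a Littlestone tree are confined to \<open>W\<close>;
  the inner vertices range over the whole graph. Answering at the root splits \<open>W\<close> in
  two, so bounds on the height follow by induction over shrinking leaf sets.\<close>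

primrec shatters :: "'a pair_pre_digraph \<Rightarrow> nat \<Rightarrow> 'a set \<Rightarrow> bool" where
  "shatters G 0 W \<longleftrightarrow> W \<noteq> {}"
| "shatters G (Suc t) W \<longleftrightarrow> (\<exists>x\<in>pverts G.
     shatters G t {w\<in>W. x \<in> nbh G w} \<and> shatters G t {w\<in>W. x \<notin> nbh G w})"

lemma shatters_nonempty: "shatters G t W \<Longrightarrow> W \<noteq> {}"
  by (induction t arbitrary: W) auto

lemma shatters_mono: "shatters G t W \<Longrightarrow> W \<subseteq> W' \<Longrightarrow> shatters G t W'"
proof (induction t arbitrary: W W')
  case (Suc t)
  then obtain x where x: "x \<in> pverts G" "shatters G t {w\<in>W. x \<in> nbh G w}"
    "shatters G t {w\<in>W. x \<notin> nbh G w}" by auto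
  have "shatters G t {w\<in>W'. x \<in> nbh G w}"
    by (rule Suc.IH[OF x(2)]) (use Suc.prems in auto)
  moreover have "shatters G t {w\<in>W'. x \<notin> nbh G w}"
    by (rule Suc.IH[OF x(3)]) (use Suc.prems in auto)
  ultimately show ?case using x(1) by auto
qed auto

text \<open>The two halves are disjoint and each has more than \<open>t\<close> elements by
  induction. This linear bound is enough for the neighbourhood of a point, which has at most
  \<open>l\<close> elements.\<close>

lemma shatters_less_card: "shatters G t W \<Longrightarrow> finite W \<Longrightarrow> t < card W"
proof (induction t arbitrary: W)
  case (Suc t)
  then obtain x where x: "shatters G t {w\<in>W. x \<in> nbh G w}" "shatters G t {w\<in>W. x \<notin> nbh G w}"
    by auto
  have "card W = card ({w\<in>W. x \<in> nbh G w} \<union> {w\<in>W. x \<notin> nbh G w})"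
    by (rule arg_cong[of _ _ card]) auto
  also have "\<dots> = card {w\<in>W. x \<in> nbh G w} + card {w\<in>W. x \<notin> nbh G w}"
    by (rule card_Un_disjoint) (use Suc.prems in auto)
  finally show ?case using Suc.IH[OF x(1)] Suc.IH[OF x(2)] Suc.prems by auto
qed (auto simp: card_gt_0_iff)

lemma shatters_if_littlestone_tree:
  assumes "\<And>\<sigma>. length \<sigma> < t \<Longrightarrow> x \<sigma> \<in> pverts G"
    and "\<And>\<tau>. length \<tau> = t \<Longrightarrow> w \<tau> \<in> W"
    and "\<And>\<tau> i. length \<tau> = t \<Longrightarrow> i < t \<Longrightarrow> x (take i \<tau>) \<in> nbh G (w \<tau>) \<longleftrightarrow> \<tau> ! i"
  shows "shatters G t W"
  using assms
proof (induction t arbitrary: x w W)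
  case 0
  from 0(2)[of "[]"] show ?case by auto
next
  case (Suc t)
  have root: "x [] \<in> nbh G (w (c # \<tau>)) \<longleftrightarrow> c" if "length \<tau> = t" for c \<tau>
    using Suc.prems(3)[of "c # \<tau>" 0] that by simp
  \<comment> \<open>Prefixing every string with \<open>c\<close> gives the subtree on the
    \<open>c\<close>-side of the root; its leaves all answer \<open>c\<close> at
    \<open>x []\<close>.\<close>
  have "shatters G t {v\<in>W. (x [] \<in> nbh G v) = c}" for c
  proof (rule Suc.IH[of "\<lambda>\<sigma>. x (c # \<sigma>)" "\<lambda>\<tau>. w (c # \<tau>)"])
    show "w (c # \<tau>) \<in> {v\<in>W. (x [] \<in> nbh G v) = c}" if "length \<tau> = t" for \<tau>
      using Suc.prems(2)[of "c # \<tau>"] root that by auto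
    show "x (c # take i \<tau>) \<in> nbh G (w (c # \<tau>)) \<longleftrightarrow> \<tau> ! i" if "length \<tau> = t" "i < t" for \<tau> i
      using Suc.prems(3)[of "c # \<tau>" "Suc i"] that by simp
  qed (use Suc.prems(1) in auto)
  from this[of True] this[of False] show ?case
    using Suc.prems(1)[of "[]"] by auto
qed

lemma Lit_le_if_not_shatters:
  assumes "finite (pverts G)" "pverts G \<noteq> {}"
    and "\<And>t. shatters G t (pverts G) \<Longrightarrow> t \<le> l"
  shows "Lit G \<le> l"
proof -
  have "has_littlestone_tree G (Lit G)"
    using assms by (intro has_littlestone_tree_Lit)
  then have "shatters G (Lit G) (pverts G)"
    unfolding has_littlestone_tree_def by (auto intro: shatters_if_littlestone_tree)
  then show ?thesis by (rule assms)
qed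

section \<open>The graph of words and prefixes\<close>

text \<open>A vertex is the code of a pair \<open>(\<sigma>, i)\<close>: the centre of \<open>\<sigma>\<close> if \<open>i = 0\<close>, and the
  \<open>i\<close>-th point of the cell \<open>\<sigma>\<close> if \<open>i \<ge> 1\<close>.\<close>

definition vertex :: "nat list \<Rightarrow> nat \<Rightarrow> nat" where
  "vertex \<sigma> i = prod_encode (list_encode \<sigma>, i)"

definition lab :: "nat \<Rightarrow> nat list" where
  "lab v = list_decode (fst (prod_decode v))"

definition idx :: "nat \<Rightarrow> nat" where
  "idx v = snd (prod_decode v)"

lemma lab_vertex [simp]: "lab (vertex \<sigma> i) = \<sigma>"
  and idx_vertex [simp]: "idx (vertex \<sigma> i) = i"
  and vertex_lab_idx [simp]: "vertex (lab v) (idx v) = v"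
  by (simp_all add: vertex_def lab_def idx_def)

lemma eq_if_lab_idx_eq: "lab v = lab w \<Longrightarrow> idx v = idx w \<Longrightarrow> v = w"
  by (metis vertex_lab_idx)

text \<open>The cell \<open>[m]\<close>, of size \<open>b\<close>, is the large one; the \<open>m ^ l\<close> others have size \<open>a\<close>.\<close>

locale prefix_graph =
  fixes l m a b :: nat
  assumes l_pos: "l \<ge> 1"
begin

definition cells :: "nat list set" where
  "cells = insert [m] {\<sigma>. set \<sigma> \<subseteq> {..<m} \<and> length \<sigma> = l}"

text \<open>The letter \<open>m\<close> is outside the alphabet, so \<open>[m]\<close> is
  prefix-incomparable to every other node. The empty word is left out: its centre would see all
  points and add a level to the laminar family.\<close>

definition nodes :: "nat list set" where
  "nodes = insert [m] {\<rho>. set \<rho> \<subseteq> {..<m} \<and> length \<rho> \<le> l \<and> \<rho> \<noteq> []}"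

definition cell_size :: "nat list \<Rightarrow> nat" where
  "cell_size \<sigma> = (if \<sigma> = [m] then b else a)"

definition centres :: "nat set" where
  "centres = (\<lambda>\<rho>. vertex \<rho> 0) ` nodes"

definition points :: "nat set" where
  "points = {v. lab v \<in> cells \<and> 0 < idx v \<and> idx v \<le> cell_size (lab v)}"

text \<open>Cones form a laminar family: they are nested if one word is a prefix of the other, and
  disjoint if the words are incomparable.\<close>

definition cone :: "nat list \<Rightarrow> nat set" where
  "cone \<rho> = {v \<in> points. prefix \<rho> (lab v)}"

definition G :: "nat pair_pre_digraph" where
  "G = \<lparr>pverts = centres \<union> points,
        parcs = {(u, v). u \<in> centres \<and> v \<in> cone (lab u) \<or> v \<in> centres \<and> u \<in> cone (lab v)}\<rparr>"

lemma finite_cells: "finite cells"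
  by (simp add: cells_def finite_lists_length_eq)

lemma finite_nodes: "finite nodes"
proof (rule finite_subset)
  show "nodes \<subseteq> insert [m] {\<rho>. set \<rho> \<subseteq> {..<m} \<and> length \<rho> \<le> l}" by (auto simp: nodes_def)
qed (simp add: finite_lists_length_le)

lemma finite_centres: "finite centres"
  by (simp add: centres_def finite_nodes)

lemma card_centres: "card centres = card nodes"
  unfolding centres_def by (intro card_image inj_onI) (metis lab_vertex)

lemma points_eq: "points = (\<lambda>(\<sigma>, i). vertex \<sigma> i) ` (SIGMA \<sigma>:cells. {1..cell_size \<sigma>})"
proof (intro equalityI subsetI)
  fix v assume "v \<in> points"
  then have "(lab v, idx v) \<in> (SIGMA \<sigma>:cells. {1..cell_size \<sigma>})"
    by (auto simp: points_def)
  then have "(\<lambda>(\<sigma>, i). vertex \<sigma> i) (lab v, idx v)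
      \<in> (\<lambda>(\<sigma>, i). vertex \<sigma> i) ` (SIGMA \<sigma>:cells. {1..cell_size \<sigma>})"
    by (rule imageI)
  then show "v \<in> (\<lambda>(\<sigma>, i). vertex \<sigma> i) ` (SIGMA \<sigma>:cells. {1..cell_size \<sigma>})" by simp
qed (auto simp: points_def)

lemma finite_points: "finite points"
  by (simp add: points_eq finite_cells)

lemma card_points: "card points = a * m ^ l + b"
proof -
  let ?S = "{\<sigma>. set \<sigma> \<subseteq> {..<m} \<and> length \<sigma> = l}"
  have "inj_on (\<lambda>(\<sigma>, i). vertex \<sigma> i) (SIGMA \<sigma>:cells. {1..cell_size \<sigma>})"
    by (rule inj_onI, clarsimp) (metis lab_vertex idx_vertex)
  then have "card points = (\<Sum>\<sigma>\<in>cells. cell_size \<sigma>)"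
    by (simp add: points_eq card_image finite_cells)
  also have "\<dots> = b + (\<Sum>\<sigma>\<in>?S. cell_size \<sigma>)"
    unfolding cells_def by (subst sum.insert) (auto simp: finite_lists_length_eq cell_size_def)
  also have "(\<Sum>\<sigma>\<in>?S. cell_size \<sigma>) = (\<Sum>\<sigma>\<in>?S. a)"
    by (rule sum.cong) (auto simp: cell_size_def)
  also have "\<dots> = a * m ^ l"
    by (simp add: card_lists_length_eq)
  finally show ?thesis by simp
qed

lemma centres_points_disjoint: "centres \<inter> points = {}"
  by (auto simp: centres_def points_def)

lemma finite_pverts: "finite (pverts G)"
  by (simp add: G_def finite_centres finite_points)

lemma card_pverts: "card (pverts G) = card nodes + a * m ^ l + b"
  using card_Un_disjoint[OF finite_centres finite_points centres_points_disjoint]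
  by (simp add: G_def card_points card_centres)

lemma cone_subset_points: "cone \<rho> \<subseteq> points"
  by (auto simp: cone_def)

lemma cone_subset_pverts: "cone \<rho> \<subseteq> pverts G"
  using cone_subset_points by (auto simp: G_def)

lemma cone_not_centre: "v \<in> cone \<rho> \<Longrightarrow> v \<notin> centres"
  using cone_subset_points centres_points_disjoint by blast

lemma finite_cone: "finite (cone \<rho>)"
  using cone_subset_points finite_points finite_subset by blast

lemma pair_graph_G: "pair_graph G"
proof -
  have "parcs G \<subseteq> pverts G \<times> pverts G"
    using cone_subset_pverts by (auto simp: G_def)
  moreover have "finite (parcs G)"
    using calculation finite_pverts finite_subset by blast
  moreover have "fst e \<noteq> snd e" if "e \<in> parcs G" for e
    using that by (auto simp: G_def dest: cone_not_centre)
  moreover have "(v, u) \<in> parcs G" if "(u, v) \<in> parcs G" for u v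
    using that by (auto simp: G_def)
  ultimately show ?thesis
    by unfold_locales (auto simp: finite_pverts symmetric_def arcs_ends_def arc_to_ends_def sym_def)
qed

section \<open>Neighbourhoods and the bound on the Littlestone dimension\<close>

lemma nbh_centre: "\<rho> \<in> nodes \<Longrightarrow> nbh G (vertex \<rho> 0) = cone \<rho>"
  using cone_subset_pverts[of \<rho>] by (auto simp: nbh_def G_def centres_def cone_def points_def)

lemma nbh_point: "v \<in> points \<Longrightarrow> nbh G v = {u \<in> centres. v \<in> cone (lab u)}"
  using centres_points_disjoint by (auto simp: nbh_def G_def)

lemma mem_nbh_sym: "u \<in> pverts G \<Longrightarrow> v \<in> pverts G \<Longrightarrow> u \<in> nbh G v \<longleftrightarrow> v \<in> nbh G u"
  by (auto simp: nbh_def G_def)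

lemma length_node: "\<rho> \<in> nodes \<Longrightarrow> length \<rho> \<le> l"
  using l_pos by (auto simp: nodes_def)

text \<open>The neighbours of a point are centres of prefixes of its label, and a word has only one
  prefix of each length from 1 to \<open>l\<close>.\<close>

lemma card_nbh_point_le:
  assumes "v \<in> points"
  shows "card (nbh G v) \<le> l"
proof -
  have "card (nbh G v) \<le> card {1..l}"
  proof (rule card_inj_on_le)
    show "inj_on (\<lambda>u. length (lab u)) (nbh G v)"
    proof (rule inj_onI)
      fix u w assume "u \<in> nbh G v" "w \<in> nbh G v" and len: "length (lab u) = length (lab w)"
      then have "prefix (lab u) (lab v)" "prefix (lab w) (lab v)" "idx u = 0" "idx w = 0"
        using assms by (auto simp: nbh_point cone_def centres_def)
      moreover from this have "lab u = lab w"
        using len by (auto simp: prefix_def)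
      ultimately show "u = w"
        by (simp add: eq_if_lab_idx_eq)
    qed
    show "(\<lambda>u. length (lab u)) ` nbh G v \<subseteq> {1..l}"
      using length_node assms l_pos by (auto simp: nbh_point centres_def nodes_def Suc_le_eq)
  qed simp
  then show ?thesis by simp
qed

lemma finite_nbh: "finite (nbh G v)"
  using finite_pverts by (simp add: nbh_def)

text \<open>On a cone, only centres of strictly longer words split, and their neighbourhoods are
  strictly smaller cones.\<close>

lemma shatters_cone:
  assumes "shatters G t W" "W \<subseteq> cone \<rho>" "length \<rho> \<le> l"
  shows "t \<le> l - length \<rho>"
  using assms
proof (induction t arbitrary: W \<rho>)
  case (Suc t)
  then obtain x where x: "x \<in> pverts G" "shatters G t {w\<in>W. x \<in> nbh G w}"
    "shatters G t {w\<in>W. x \<notin> nbh G w}"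
    by auto
  \<comment> \<open>The point \<open>y\<close> shows that \<open>x\<close> is a centre whose word is
    comparable with \<rho>; the point \<open>z\<close> shows that this word is not a prefix of
    \<rho>, so it is strictly longer.\<close>
  obtain y z where y: "y \<in> W" "x \<in> nbh G y" and z: "z \<in> W" "x \<notin> nbh G z"
    using shatters_nonempty[OF x(2)] shatters_nonempty[OF x(3)] by blast
  have W: "W \<subseteq> points" using Suc.prems(2) cone_subset_points by blast
  then have "y \<in> points" using y by blast
  then obtain \<rho>' where \<rho>': "\<rho>' \<in> nodes" "x = vertex \<rho>' 0"
    using y by (auto simp: nbh_point centres_def)
  have nbr: "x \<in> nbh G w \<longleftrightarrow> w \<in> cone \<rho>'" if "w \<in> W" for w
    using that W x(1) mem_nbh_sym[of x w] nbh_centre[OF \<rho>'(1)] \<rho>'(2) by (auto simp: G_def)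
  have "y \<in> cone \<rho>'" "z \<notin> cone \<rho>'" "y \<in> cone \<rho>" "z \<in> cone \<rho>"
    using nbr y z Suc.prems(2) by auto
  then have "prefix \<rho> (lab y)" "prefix \<rho>' (lab y)" "\<not> prefix \<rho>' \<rho>"
    using prefix_order.trans[of \<rho>' \<rho> "lab z"] by (auto simp: cone_def)
  then have "length \<rho> < length \<rho>'"
    by (meson linorder_not_le prefix_length_prefix)
  moreover have "t \<le> l - length \<rho>'"
    by (rule Suc.IH[OF x(2)]) (use nbr length_node[OF \<rho>'(1)] in auto)
  ultimately show ?case using length_node[OF \<rho>'(1)] by linarith
qed simp

text \<open>Restrict the leaves to the neighbours of the root \<open>x\<close>. If \<open>x\<close>
  is a point, these are at most \<open>l\<close> centres; if \<open>x\<close> is a centre, they form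
  the cone of a non-empty word. Either way the remaining height is below \<open>l\<close>.\<close>

lemma Lit_G: "Lit G \<le> l"
proof (rule Lit_le_if_not_shatters[OF finite_pverts])
  show "pverts G \<noteq> {}"
    by (auto simp: G_def centres_def nodes_def)
  show "t \<le> l" if t: "shatters G t (pverts G)" for t
  proof (cases t)
    case (Suc s)
    then obtain x where x: "x \<in> pverts G" "shatters G s {w\<in>pverts G. x \<in> nbh G w}"
      using t by auto
    have s: "shatters G s (nbh G x)"
      by (rule shatters_mono[OF x(2)]) (use mem_nbh_sym x(1) in auto)
    show ?thesis
    proof (cases "x \<in> points")
      case True
      then show ?thesis
        using shatters_less_card[OF s finite_nbh] card_nbh_point_le Suc by fastforce
    next
      case False
      then obtain \<rho> where \<rho>: "\<rho> \<in> nodes" "x = vertex \<rho> 0"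
        using x(1) by (auto simp: G_def centres_def)
      then have "s \<le> l - length \<rho>"
        using s length_node by (intro shatters_cone[OF _ order_refl]) (simp_all add: nbh_centre)
      moreover have "\<rho> \<noteq> []"
        using \<rho>(1) by (auto simp: nodes_def)
      ultimately show ?thesis using Suc length_node[OF \<rho>(1)] by (cases \<rho>) auto
    qed
  qed simp
qed

section \<open>How good sets meet the cones\<close>

lemma points_eq_cones: "points = cone [m] \<union> (\<Union>i<m. cone [i])"
proof -
  have "lab v = [m] \<or> (\<exists>i<m. prefix [i] (lab v))" if "v \<in> points" for v
    using that l_pos by (cases "lab v") (auto simp: points_def cells_def)
  moreover have "v \<in> points \<Longrightarrow> lab v = [m] \<Longrightarrow> v \<in> cone [m]" for v
    by (simp add: cone_def)
  ultimately show ?thesis by (fastforce simp: cone_def)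
qed

text \<open>Such a word is not itself a cell, so every label in its cone has a next letter, which is
  below \<open>m\<close>. The empty word differs: its cone also contains the large cell.\<close>

lemma cone_eq_cones:
  assumes "set \<rho> \<subseteq> {..<m}" "length \<rho> < l" "\<rho> \<noteq> []"
  shows "cone \<rho> = (\<Union>i<m. cone (\<rho> @ [i]))"
proof -
  have "\<exists>i<m. prefix (\<rho> @ [i]) (lab v)" if "v \<in> cone \<rho>" for v
  proof -
    have v: "lab v \<in> cells" and "prefix \<rho> (lab v)"
      using that by (auto simp: cone_def points_def)
    then obtain \<tau> where \<tau>: "lab v = \<rho> @ \<tau>"
      by (auto simp: prefix_def)
    with v have "set \<tau> \<subseteq> {..<m}" "\<tau> \<noteq> []"
      using assms by (auto simp: cells_def append_eq_Cons_conv)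
    then show ?thesis using \<tau> by (cases \<tau>) auto
  qed
  then show ?thesis by (auto simp: cone_def dest: append_prefixD)
qed

text \<open>Distinct cells are prefix-incomparable, so the cone of a cell contains the points of
  that cell only.\<close>

lemma card_cone_le:
  assumes "\<sigma> \<in> cells"
  shows "card (cone \<sigma>) \<le> cell_size \<sigma>"
proof -
  have "lab v = \<sigma>" if "v \<in> cone \<sigma>" for v
  proof -
    have v: "lab v \<in> cells" and "prefix \<sigma> (lab v)"
      using that by (auto simp: cone_def points_def)
    then obtain \<tau> where \<tau>: "lab v = \<sigma> @ \<tau>"
      by (auto simp: prefix_def)
    then have "\<tau> = []"
      using v assms l_pos by (cases \<sigma>) (auto simp: cells_def)
    then show ?thesis using \<tau> by simp
  qed
  moreover from this have "v = vertex \<sigma> (idx v)" if "v \<in> cone \<sigma>" for v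
    using that by (simp add: eq_if_lab_idx_eq)
  ultimately have "cone \<sigma> \<subseteq> vertex \<sigma> ` {1..cell_size \<sigma>}"
    by (fastforce simp: cone_def points_def)
  then have "card (cone \<sigma>) \<le> card (vertex \<sigma> ` {1..cell_size \<sigma>})"
    by (intro card_mono) auto
  also have "\<dots> \<le> cell_size \<sigma>"
    using card_image_le[of "{1..cell_size \<sigma>}" "vertex \<sigma>"] by simp
  finally show ?thesis .
qed

text \<open>Goodness is tested at the centre of \<rho>, whose neighbourhood is the cone; the two
  values of the exponent yield the two alternatives.\<close>

lemma good_set_cone:
  assumes U: "good_set \<epsilon> G U" and \<rho>: "\<rho> \<in> nodes"
  shows "real (card (cone \<rho> \<inter> U)) \<le> \<epsilon> * real (card U) \<or>
    (1 - \<epsilon>) * real (card U) \<le> real (card (cone \<rho> \<inter> U))"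
proof -
  have "U \<subseteq> pverts G" using U by (simp add: good_set_def)
  then have fin: "finite U" using finite_pverts finite_subset by blast
  have "vertex \<rho> 0 \<in> pverts G" using \<rho> by (auto simp: G_def centres_def)
  then obtain c where c: "(1 - \<epsilon>) * real (card U) \<le> real (card (nbh_pow c G (vertex \<rho> 0) \<inter> U))"
    using U by (auto simp: good_set_def)
  show ?thesis
  proof (cases c)
    case True
    then show ?thesis using c \<rho> by (simp add: nbh_pow_def nbh_centre)
  next
    case False
    have "nbh_pow c G (vertex \<rho> 0) \<inter> U = U - cone \<rho> \<inter> U"
      using False \<rho> \<open>U \<subseteq> pverts G\<close> by (auto simp: nbh_pow_def nbh_centre)
    moreover have "card (U - cone \<rho> \<inter> U) = card U - card (cone \<rho> \<inter> U)"
      using fin by (intro card_Diff_subset) auto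
    moreover have "card (cone \<rho> \<inter> U) \<le> card U"
      using fin by (intro card_mono) auto
    ultimately show ?thesis using c by (simp add: algebra_simps of_nat_diff)
  qed
qed

lemma card_UN_cones_le:
  assumes "\<And>i. i < m \<Longrightarrow> real (card (cone (\<rho> @ [i]) \<inter> U)) \<le> c"
  shows "real (card ((\<Union>i<m. cone (\<rho> @ [i])) \<inter> U)) \<le> real m * c"
proof -
  have "card ((\<Union>i<m. cone (\<rho> @ [i])) \<inter> U) = card (\<Union>i<m. cone (\<rho> @ [i]) \<inter> U)"
    by (rule arg_cong[of _ _ card]) auto
  also have "\<dots> \<le> (\<Sum>i<m. card (cone (\<rho> @ [i]) \<inter> U))"
    by (rule card_UN_le) simp
  finally have "real (card ((\<Union>i<m. cone (\<rho> @ [i])) \<inter> U)) \<le> (\<Sum>i<m. real (card (cone (\<rho> @ [i]) \<inter> U)))"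
    by (simp flip: of_nat_sum)
  also have "\<dots> \<le> (\<Sum>i<m. c)"
    by (rule sum_mono) (use assms in auto)
  finally show ?thesis by simp
qed

text \<open>A cell is too small to contain most of \<open>U\<close>, and \<open>m\<close> cones carrying at most an
  \<open>\<epsilon>\<close>-fraction each cannot add up to a \<open>(1 - \<epsilon>)\<close>-fraction.\<close>

lemma good_set_small_cone:
  assumes U: "good_set \<epsilon> G U" and \<epsilon>: "(real m + 1) * \<epsilon> < 1" and large: "real a < (1 - \<epsilon>) * real (card U)"
    and \<rho>: "set \<rho> \<subseteq> {..<m}" "length \<rho> \<le> l" "\<rho> \<noteq> []"
  shows "real (card (cone \<rho> \<inter> U)) \<le> \<epsilon> * real (card U)"
  using \<rho>
\<comment> \<open>The induction climbs from the cells, of length \<open>l\<close>, to shorter words.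
  At each level the alternative of carrying a (1 - \<epsilon>)-fraction is refuted.\<close>
proof (induction "l - length \<rho>" arbitrary: \<rho>)
  case 0
  then have "length \<rho> = l" by simp
  then have "\<rho> \<in> cells" "cell_size \<rho> = a"
    using 0 unfolding cells_def cell_size_def by auto
  then have "card (cone \<rho> \<inter> U) \<le> a"
    using card_cone_le[of \<rho>] card_mono[OF finite_cone, of "cone \<rho> \<inter> U" \<rho>] by auto
  then have "\<not> (1 - \<epsilon>) * real (card U) \<le> real (card (cone \<rho> \<inter> U))"
    using large by linarith
  moreover have "\<rho> \<in> nodes" using 0 unfolding nodes_def by auto
  ultimately show ?case using good_set_cone[OF U] by blast
next
  case (Suc k)
  have "real (card (cone \<rho> \<inter> U)) \<le> real m * (\<epsilon> * real (card U))"
    using Suc by (subst cone_eq_cones) (auto intro!: card_UN_cones_le)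
  also have "\<dots> < (1 - \<epsilon>) * real (card U)"
  proof -
    have "0 < card U" using large by (cases "card U") auto
    then have "(real m + 1) * \<epsilon> * real (card U) < 1 * real (card U)"
      by (intro mult_strict_right_mono \<epsilon>) simp
    then show ?thesis by (simp add: algebra_simps)
  qed
  finally have "\<not> (1 - \<epsilon>) * real (card U) \<le> real (card (cone \<rho> \<inter> U))"
    by linarith
  moreover have "\<rho> \<in> nodes" using Suc by (auto simp: nodes_def)
  ultimately show ?case using good_set_cone[OF U] by blast
qed

text \<open>Otherwise all \<open>m + 1\<close> top-level cones carry at most an \<epsilon>-fraction
  each. The fraction 1 - (m + 1)\<epsilon> left over would consist of centres, and there are too few
  of them.\<close>

lemma good_set_large_cell:
  assumes U: "good_set \<epsilon> G U" and \<epsilon>: "(real m + 1) * \<epsilon> < 1"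
    and large: "real a < (1 - \<epsilon>) * real (card U)"
    and few: "real (card nodes) < (1 - (real m + 1) * \<epsilon>) * real (card U)"
  shows "(1 - \<epsilon>) * real (card U) \<le> real (card (cone [m] \<inter> U))"
proof (rule ccontr)
  assume "\<not> ?thesis"
  moreover have "[m] \<in> nodes" by (simp add: nodes_def)
  ultimately have big: "real (card (cone [m] \<inter> U)) \<le> \<epsilon> * real (card U)"
    using good_set_cone[OF U] by blast
  have small: "real (card ((\<Union>i<m. cone [i]) \<inter> U)) \<le> real m * (\<epsilon> * real (card U))"
    using card_UN_cones_le[of "[]" U] good_set_small_cone[OF U \<epsilon> large] l_pos by auto
  have "U = (centres \<inter> U) \<union> ((cone [m] \<inter> U) \<union> ((\<Union>i<m. cone [i]) \<inter> U))"
    using U points_eq_cones by (auto simp: good_set_def G_def)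
  then have "card U \<le> card (centres \<inter> U) + (card (cone [m] \<inter> U) + card ((\<Union>i<m. cone [i]) \<inter> U))"
    by (metis (no_types, lifting) add_left_mono card_Un_le order_trans)
  moreover have "card (centres \<inter> U) \<le> card nodes"
    using card_mono[OF finite_centres, of "centres \<inter> U"] by (simp add: card_centres)
  ultimately have "real (card U) \<le> real (card nodes) + real (card (cone [m] \<inter> U))
      + real (card ((\<Union>i<m. cone [i]) \<inter> U))"
    by linarith
  then show False using big small few by (simp add: algebra_simps)
qed

section \<open>Counting the parts of a good equipartition\<close>

lemma card_nodes_pos: "0 < card nodes"
  using finite_nodes by (auto simp: card_gt_0_iff nodes_def)

text \<open>If every part were large, each would have a (1 - \<epsilon>)-fraction inside the cell
  \<open>[m]\<close>. Summing over the parts, \<open>b\<close> would be at least (1 - \<epsilon>)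
  times the order of the graph.\<close>

lemma ex_small_part:
  assumes P: "good_equipartition \<epsilon> G P" and \<epsilon>: "\<epsilon> < 1" "(real m + 1) * \<epsilon> < 1"
    and b: "\<epsilon> * real b \<le> (1 - \<epsilon>) * real (a * m ^ l)"
    and few: "(1 - \<epsilon>) * real (card nodes) \<le> (1 - (real m + 1) * \<epsilon>) * real a"
  shows "\<exists>U\<in>P. (1 - \<epsilon>) * real (card U) \<le> real a"
proof (rule ccontr)
  assume "\<not> ?thesis"
  then have large: "real a < (1 - \<epsilon>) * real (card U)" if "U \<in> P" for U
    using that by force
  have good: "good_set \<epsilon> G U" if "U \<in> P" for U
    using P that by (auto simp: good_equipartition_def)
  have part: "partition_on (pverts G) P" using P by (simp add: good_equipartition_def)
  have finP: "finite P" using finite_elements[OF finite_pverts part] .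
  have sub: "U \<subseteq> pverts G" if "U \<in> P" for U using part that by (auto simp: partition_on_def)
  then have finU: "finite U" if "U \<in> P" for U using finite_pverts finite_subset that by blast
  have disj: "U \<inter> W = {}" if "U \<in> P" "W \<in> P" "U \<noteq> W" for U W
    using part that by (auto simp: partition_on_def disjoint_def)
  have most: "(1 - \<epsilon>) * real (card U) \<le> real (card (cone [m] \<inter> U))" if "U \<in> P" for U
  proof (rule good_set_large_cell[OF good \<epsilon>(2) large])
    \<comment> \<open>A large part has more than a/(1 - \<epsilon>) vertices, which carries the
      condition on \<open>a\<close> over to \<open>U\<close>.\<close>
    have "(1 - \<epsilon>) * real (card nodes) \<le> (1 - (real m + 1) * \<epsilon>) * real a" by (rule few)
    also have "\<dots> < (1 - (real m + 1) * \<epsilon>) * ((1 - \<epsilon>) * real (card U))"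
      using large[OF that] \<epsilon> by (intro mult_strict_left_mono) auto
    finally have "(1 - \<epsilon>) * real (card nodes) < (1 - \<epsilon>) * ((1 - (real m + 1) * \<epsilon>) * real (card U))"
      by (simp only: mult_ac)
    then show "real (card nodes) < (1 - (real m + 1) * \<epsilon>) * real (card U)"
      using \<epsilon>(1) by (simp add: mult_less_cancel_left)
  qed (use that in auto)
  have "card (pverts G) = (\<Sum>U\<in>P. card U)"
    using part card_Union_disjoint[of P] finU by (auto simp: partition_on_def disjoint_def pairwise_def)
  then have "(1 - \<epsilon>) * real (card (pverts G)) = (\<Sum>U\<in>P. (1 - \<epsilon>) * real (card U))"
    by (simp add: sum_distrib_left)
  also have "\<dots> \<le> (\<Sum>U\<in>P. real (card (cone [m] \<inter> U)))"
    by (rule sum_mono) (rule most)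
  also have "\<dots> = real (card (\<Union>U\<in>P. cone [m] \<inter> U))"
    using card_UN_disjoint[OF finP, of "\<lambda>U. cone [m] \<inter> U"] finite_cone disj by fastforce
  also have "\<dots> \<le> real (card (cone [m]))"
    by (intro of_nat_mono card_mono finite_cone) auto
  also have "\<dots> \<le> real b"
    using card_cone_le[of "[m]"] by (simp add: cells_def cell_size_def)
  finally have "(1 - \<epsilon>) * (real (card nodes) + real (a * m ^ l) + real b) \<le> real b"
    by (simp add: card_pverts)
  \<comment> \<open>The choice of \<open>b\<close> makes it at most a (1 - \<epsilon>)-fraction of
    the points alone; the centres, being present, turn this into a contradiction.\<close>
  moreover have "(1 - \<epsilon>) * real (card nodes) > 0"
    using \<epsilon>(1) card_nodes_pos by simp
  ultimately show False using b by (simp add: algebra_simps)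
qed

text \<open>One part has at most a/(1 - \<epsilon>) vertices, so equitability bounds every part by
  one more than that, while the graph has at least \<open>a * m ^ l\<close> / \<epsilon>
  vertices.\<close>

lemma card_good_equipartition:
  assumes P: "good_equipartition \<epsilon> G P" and \<epsilon>: "0 < \<epsilon>" "\<epsilon> < 1" "(real m + 1) * \<epsilon> < 1"
    and b: "b = nat \<lfloor>(1 - \<epsilon>) * real (a * m ^ l) / \<epsilon>\<rfloor>" and a: "1 \<le> \<epsilon> * real a"
    and few: "(1 - \<epsilon>) * real (card nodes) \<le> (1 - (real m + 1) * \<epsilon>) * real a"
  shows "(1 - \<epsilon>)\<^sup>2 * real m ^ l / \<epsilon> \<le> real (card P)"
proof -
  let ?A = "real (a * m ^ l)"
  have b_le: "real b \<le> (1 - \<epsilon>) * ?A / \<epsilon>" and b_ge: "(1 - \<epsilon>) * ?A / \<epsilon> < real b + 1"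
    using \<epsilon> unfolding b by (simp_all add: of_nat_floor)
  have "\<epsilon> * real b \<le> (1 - \<epsilon>) * ?A"
    using b_le \<epsilon>(1) by (simp add: field_simps)
  from ex_small_part[OF P \<epsilon>(2,3) this few]
  obtain U where U: "U \<in> P" "(1 - \<epsilon>) * real (card U) \<le> real a" by blast
  have a_pos: "real a > 0" using a \<epsilon>(1) by (cases a) auto
  have part_le: "real (card W) \<le> real a / (1 - \<epsilon>)\<^sup>2" if "W \<in> P" for W
  proof -
    have "\<bar>int (card W) - int (card U)\<bar> \<le> 1"
      using P U(1) that by (auto simp: good_equipartition_def)
    then have "real (card W) \<le> real (card U) + 1" by linarith
    also have "\<dots> \<le> real a / (1 - \<epsilon>) + 1"
      using U(2) \<epsilon>(2) by (simp add: field_simps)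
    also have "\<dots> \<le> real a / (1 - \<epsilon>)\<^sup>2"
    proof -
      have "(1 - \<epsilon>)\<^sup>2 \<le> 1" using \<epsilon> by (simp add: power_le_one)
      \<comment> \<open>The rounding term is absorbed because the slack \<epsilon>a is at least
        1.\<close>
      then have "real a * (1 - \<epsilon>) + (1 - \<epsilon>)\<^sup>2 \<le> real a"
        using a by (simp add: algebra_simps)
      then have "(real a * (1 - \<epsilon>) + (1 - \<epsilon>)\<^sup>2) / (1 - \<epsilon>)\<^sup>2 \<le> real a / (1 - \<epsilon>)\<^sup>2"
        by (rule divide_right_mono) simp
      then show ?thesis using \<epsilon>(2) by (simp add: add_divide_distrib power2_eq_square)
    qed
    finally show ?thesis .
  qed
  \<comment> \<open>The floor in \<open>b\<close> loses less than one vertex, and at least one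
    centre makes up for it.\<close>
  have "?A / \<epsilon> = ?A + (1 - \<epsilon>) * ?A / \<epsilon>"
    using \<epsilon>(1) by (simp add: field_simps)
  also have "\<dots> \<le> real (card (pverts G))"
    using b_ge card_nodes_pos by (simp add: card_pverts)
  also have "\<dots> \<le> (\<Sum>W\<in>P. real (card W))"
  proof -
    have "pverts G = \<Union>P" using P by (auto simp: good_equipartition_def partition_on_def)
    then have "card (pverts G) \<le> (\<Sum>W\<in>P. card W)"
      by (simp add: card_Union_le_sum_card)
    then show ?thesis by (simp flip: of_nat_sum)
  qed
  also have "\<dots> \<le> real (card P) * (real a / (1 - \<epsilon>)\<^sup>2)"
    by (rule sum_bounded_above) (rule part_le)
  finally have "real a * (real m ^ l / \<epsilon>) \<le> real a * (real (card P) / (1 - \<epsilon>)\<^sup>2)"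
    by (simp add: mult_ac)
  then have "real m ^ l / \<epsilon> \<le> real (card P) / (1 - \<epsilon>)\<^sup>2"
    using a_pos by (simp only: mult_le_cancel_left_pos)
  then show ?thesis using \<epsilon>(2) by (simp add: field_simps)
qed

end

section \<open>Choice of parameters and the asymptotic bound\<close>

text \<open>The factor (1 - \<epsilon>) squared comes from the part sizes, and the
  \<open>l\<close>-th power of 1 - 2\<epsilon> from replacing \<open>m\<close> by its lower bound (1
  - 2\<epsilon>)/\<epsilon>.\<close>

lemma ex_graph_large_good_equipartitions:
  fixes l n\<^sub>0 :: nat and \<epsilon> :: real
  assumes l: "l \<ge> 1" and \<epsilon>: "0 < \<epsilon>" "\<epsilon> < 1 / 3"
  shows "\<exists>G :: nat pair_pre_digraph. pair_graph G \<and> n\<^sub>0 \<le> card (pverts G) \<and> Lit G \<le> l \<and>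
    (\<forall>P. good_equipartition \<epsilon> G P \<longrightarrow>
      (1 - \<epsilon>)\<^sup>2 * (1 - 2 * \<epsilon>) ^ l * \<epsilon> powi (- int l - 1) \<le> real (card P))"
proof -
  \<comment> \<open>This is the largest \<open>m\<close> with m + 1 strictly below 1/\<epsilon>;
    strictness leaves the positive gap 1 - (m + 1)\<epsilon> that has to outweigh the
    centres.\<close>
  define m where "m = nat (\<lceil>1 / \<epsilon>\<rceil> - 2)"
  have "1 / \<epsilon> > 3" using \<epsilon> by (simp add: field_simps)
  then have m: "real m + 1 < 1 / \<epsilon>" "1 / \<epsilon> - 2 \<le> real m"
    unfolding m_def by linarith+
  then have m\<epsilon>: "(real m + 1) * \<epsilon> < 1"
    using \<epsilon>(1) by (simp add: field_simps)
  let ?M = "real (card (prefix_graph.nodes l m))"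
  \<comment> \<open>The three terms make the graph large, absorb the rounding of part sizes, and
    make the centres negligible. There is no circularity, since the number of centres depends on
    \<open>l\<close> and \<open>m\<close> only.\<close>
  let ?a = "max (real n\<^sub>0) (max (1 / \<epsilon>) ((1 - \<epsilon>) * ?M / (1 - (real m + 1) * \<epsilon>)))"
  define a where "a = nat \<lceil>?a\<rceil>"
  \<comment> \<open>The largest size for which the big cell holds at most a (1 -
    \<epsilon>)-fraction of all points.\<close>
  define b where "b = nat \<lfloor>(1 - \<epsilon>) * real (a * m ^ l) / \<epsilon>\<rfloor>"
  interpret prefix_graph l m a b by unfold_locales (rule l)
  have "?a \<le> real a" unfolding a_def by (rule real_nat_ceiling_ge)
  then have a: "n\<^sub>0 \<le> a" "1 \<le> \<epsilon> * real a"
    "(1 - \<epsilon>) * real (card nodes) \<le> (1 - (real m + 1) * \<epsilon>) * real a"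
    using \<epsilon>(1) m\<epsilon> by (simp_all add: pos_divide_le_eq mult.commute)
  show ?thesis
  proof (intro exI[of _ G] conjI allI impI)
    have "1 \<le> m" using m(2) \<open>1 / \<epsilon> > 3\<close> by linarith
    then have "a * 1 \<le> a * m ^ l" by (intro mult_left_mono) simp_all
    then show "n\<^sub>0 \<le> card (pverts G)" unfolding card_pverts using a(1) by linarith
    fix P assume P: "good_equipartition \<epsilon> G P"
    have "- int l - 1 = - int (Suc l)" by simp
    then have "\<epsilon> powi (- int l - 1) = inverse (\<epsilon> ^ Suc l)"
      by (simp only: power_int_minus power_int_of_nat)
    moreover have "1 / \<epsilon> - 2 = (1 - 2 * \<epsilon>) * inverse \<epsilon>"
      using \<epsilon>(1) by (simp add: field_simps)
    ultimately have "(1 - 2 * \<epsilon>) ^ l * \<epsilon> powi (- int l - 1) = (1 / \<epsilon> - 2) ^ l / \<epsilon>"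
      by (simp add: power_mult_distrib power_inverse divide_inverse)
    also have "\<dots> \<le> real m ^ l / \<epsilon>"
      using m(2) \<epsilon>(1) \<open>1 / \<epsilon> > 3\<close> by (intro divide_right_mono power_mono) auto
    finally have "(1 - \<epsilon>)\<^sup>2 * ((1 - 2 * \<epsilon>) ^ l * \<epsilon> powi (- int l - 1)) \<le> (1 - \<epsilon>)\<^sup>2 * (real m ^ l / \<epsilon>)"
      by (rule mult_left_mono) simp
    also have "\<dots> \<le> real (card P)"
      using card_good_equipartition[OF P \<epsilon>(1) _ m\<epsilon> b_def a(2,3)] \<epsilon>(2) by simp
    finally show "(1 - \<epsilon>)\<^sup>2 * (1 - 2 * \<epsilon>) ^ l * \<epsilon> powi (- int l - 1) \<le> real (card P)"
      by (simp only: mult.assoc)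
  qed (rule pair_graph_G Lit_G)+
qed

theorem corollary9p7:
  fixes l :: nat
  assumes "l \<ge> 1"
  shows "\<exists>\<eta> :: nat \<Rightarrow> real \<Rightarrow> real.
    (\<forall>\<alpha>>0. \<exists>\<epsilon>\<^sub>0>0. \<forall>\<epsilon>. 0 < \<epsilon> \<and> \<epsilon> < \<epsilon>\<^sub>0 \<longrightarrow> (\<exists>N\<^sub>0. \<forall>n\<ge>N\<^sub>0. \<bar>\<eta> n \<epsilon>\<bar> < \<alpha>)) \<and>
    (\<forall>n\<^sub>0::nat. n\<^sub>0 \<ge> 1 \<longrightarrow> (\<forall>\<epsilon>. 0 < \<epsilon> \<and> \<epsilon> < 1 / 3 \<longrightarrow>
      (\<exists>(G :: nat pair_pre_digraph) n. pair_graph G \<and> card (pverts G) = n \<and> n \<ge> n\<^sub>0 \<and> Lit G \<le> l \<and>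
        (\<forall>P. good_equipartition \<epsilon> G P \<longrightarrow>
          real (card P) \<ge> (1 + \<eta> n \<epsilon>) * \<epsilon> powi (- int l - 1)))))"
proof -
  \<comment> \<open>The relative error depends on \<epsilon> alone, since \<open>a\<close> was taken
    large enough for each \<epsilon>; hence \<eta> can be constant in \<open>n\<close>.\<close>
  define f :: "real \<Rightarrow> real" where "f \<epsilon> = (1 - \<epsilon>)\<^sup>2 * (1 - 2 * \<epsilon>) ^ l - 1" for \<epsilon>
  have "(f \<longlongrightarrow> (1 - 0)\<^sup>2 * (1 - 2 * 0) ^ l - 1) (at_right 0)"
    unfolding f_def by (intro tendsto_intros)
  then have "(f \<longlongrightarrow> 0) (at_right 0)" by simp
  then have "\<exists>\<epsilon>\<^sub>0>0. \<forall>\<epsilon>. 0 < \<epsilon> \<and> \<epsilon> < \<epsilon>\<^sub>0 \<longrightarrow> \<bar>f \<epsilon>\<bar> < \<alpha>" if "\<alpha> > 0" for \<alpha>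
    using that unfolding tendsto_iff eventually_at_right_field by (simp add: dist_real_def) meson
  moreover have "\<exists>(G :: nat pair_pre_digraph) n. pair_graph G \<and> card (pverts G) = n \<and> n \<ge> n\<^sub>0 \<and>
      Lit G \<le> l \<and> (\<forall>P. good_equipartition \<epsilon> G P \<longrightarrow>
        real (card P) \<ge> (1 + f \<epsilon>) * \<epsilon> powi (- int l - 1))" if "0 < \<epsilon>" "\<epsilon> < 1 / 3" for n\<^sub>0 \<epsilon>
    using ex_graph_large_good_equipartitions[OF assms that, of n\<^sub>0] by (auto simp: f_def)
  ultimately show ?thesis
    by (intro exI[of _ "\<lambda>n. f"]) meson
qed

end
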